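(* Let $E$ and $F$ be Riesz spaces such that $E$ is finite-dimensional. Then $L_{so}(E,F)=L_n(E,F)$ and $L_{s\sigma o}(E,F)=L_c(E,F)$.
   Context: Riesz spaces are real vector lattices; operators are linear. A net $(x_\alpha)_{\alpha\in\mathcal A}$ in a Riesz space $E$ is order convergent to $x\in E$, written $x_\alpha\xrightarrow{o}x$, if there is a net $(y_\beta)_{\beta\in\mathcal B}$ in $E$ (possibly with a different index set) such that $y_\beta\downarrow 0$ and for every $\beta\in\mathcal B$ there exists $\alpha_0\in\mathcal A$ with $|x_\alpha-x|\le y_\beta$ for all $\alpha\ge\alpha_0$. The net is unbounded order convergent to $x$, written $x_\alpha\xrightarrow{uo}x$, if $|x_\alpha-x|\wedge u\xrightarrow{o}0$ for all $u\in E^+$. The same definitions apply to sequences, regarded as nets. An operator $T:E\to F$ between Riesz spaces is: strongly order continuous ($so$-continuous) if $x_\alpha\xrightarrow{uo}0$ in $E$ implies $Tx_\alpha\xrightarrow{o}0$ in $F$ for every net $(x_\alpha)$; strongly $\sigma$-order continuous ($s\sigma o$-continuous) if $x_n\xrightarrow{uo}0$ in $E$ implies $Tx_n\xrightarrow{o}0$ in $F$ for every sequence $(x_n)$; order continuous if $x_\alpha\xrightarrow{o}0$ implies $Tx_\alpha\xrightarrow{o}0$ for every net; $\sigma$-order continuous if $x_n\xrightarrow{o}0$ implies $Tx_n\xrightarrow{o}0$ for every sequence. $L_b(E,F)$ denotes the space of order bounded operators from $E$ to $F$. $L_{so}(E,F)$, $L_{s\sigma o}(E,F)$, $L_n(E,F)$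 and $L_c(E,F)$ denote the sets of those $T\in L_b(E,F)$ that are, respectively, $so$-continuous, $s\sigma o$-continuous, order continuous and $\sigma$-order continuous. *)

theory Defs
  imports Complex_Main "HOL-Library.Lattice_Algebras" "HOL-Library.Lub_Glb"
begin

class riesz_space = ordered_real_vector + lattice_ab_group_add_abs


section \<open>Nets\<close>

text \<open>
  A directed set is represented by its preorder \<open>r\<close>; the index set is \<open>Field r\<close>, and
  \<open>(a, b) \<in> r\<close> means \<open>a \<le> b\<close>. A net is a function on the index type, of which only the values
  on \<open>Field r\<close> matter.
\<close>

definition directed_set :: "'i rel \<Rightarrow> bool" where
  "directed_set r \<longleftrightarrow> Preorder r \<and> Field r \<noteq> {} \<and>
     (\<forall>a\<in>Field r. \<forall>b\<in>Field r. \<exists>c. (a, c) \<in> r \<and> (b, c) \<in> r)"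

definition nat_order :: "nat rel" where
  "nat_order = {(m, n). m \<le> n}"

lemma directed_set_nat_order: "directed_set nat_order"
proof -
  have "Field nat_order = UNIV"
    by (auto simp: nat_order_def Field_def)
  moreover have "\<exists>c. (a, c) \<in> nat_order \<and> (b, c) \<in> nat_order" for a b
    by (rule exI[of _ "max a b"]) (simp add: nat_order_def)
  ultimately show ?thesis
    by (auto simp: directed_set_def preorder_on_def refl_on_def trans_def nat_order_def)
qed

definition decreases_to_zero :: "'i rel \<Rightarrow> ('i \<Rightarrow> 'a::riesz_space) \<Rightarrow> bool" where
  "decreases_to_zero r y \<longleftrightarrow>
     (\<forall>a b. (a, b) \<in> r \<longrightarrow> y b \<le> y a) \<and> isGlb UNIV (y ` Field r) 0"


section \<open>Order convergence and unbounded order convergence\<close>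

text \<open>
  HOL cannot quantify over the index type of the dominating net inside a formula. Taking the
  space itself as the index type is no restriction: \<open>order_convergentI\<close> below accepts
  dominating nets over an arbitrary index type.
\<close>

definition order_convergent :: "'i rel \<Rightarrow> ('i \<Rightarrow> 'a::riesz_space) \<Rightarrow> 'a \<Rightarrow> bool" where
  "order_convergent r x l \<longleftrightarrow>
     (\<exists>(s :: 'a rel) y. directed_set s \<and> decreases_to_zero s y \<and>
        (\<forall>b\<in>Field s. \<exists>a0\<in>Field r. \<forall>a. (a0, a) \<in> r \<longrightarrow> \<bar>x a - l\<bar> \<le> y b))"

definition uo_convergent :: "'i rel \<Rightarrow> ('i \<Rightarrow> 'a::riesz_space) \<Rightarrow> 'a \<Rightarrow> bool" where
  "uo_convergent r x l \<longleftrightarrow> (\<forall>u\<ge>0. order_convergent r (\<lambda>a. inf \<bar>x a - l\<bar> u) 0)"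

lemma order_convergentI:
  fixes s :: "'j rel" and y :: "'j \<Rightarrow> 'a::riesz_space"
  assumes s: "directed_set s" and y: "decreases_to_zero s y"
    and dom: "\<And>b. b \<in> Field s \<Longrightarrow> \<exists>a0\<in>Field r. \<forall>a. (a0, a) \<in> r \<longrightarrow> \<bar>x a - l\<bar> \<le> y b"
  shows "order_convergent r x l"
proof -
  define t where "t = {(u, v). u \<in> y ` Field s \<and> v \<in> y ` Field s \<and> v \<le> u}"
  have F: "Field t = y ` Field s"
    by (auto simp: t_def Field_def)
  have "\<exists>w. (u, w) \<in> t \<and> (v, w) \<in> t" if uv: "u \<in> Field t" "v \<in> Field t" for u v
  proof -
    obtain a b where ab: "a \<in> Field s" "b \<in> Field s" "u = y a" "v = y b"
      using uv F by auto
    obtain c where c: "(a, c) \<in> s" "(b, c) \<in> s"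
      using s ab unfolding directed_set_def by blast
    then have "c \<in> Field s" "y c \<le> y a" "y c \<le> y b"
      using y unfolding decreases_to_zero_def by (auto intro: FieldI2)
    then show ?thesis
      using ab unfolding t_def by blast
  qed
  moreover have "Preorder t"
    unfolding preorder_on_def F by (auto simp: t_def refl_on_def trans_def)
  moreover have "Field t \<noteq> {}"
    using s F by (auto simp: directed_set_def)
  ultimately have "directed_set t"
    unfolding directed_set_def by blast
  moreover have "decreases_to_zero t (\<lambda>u. u)"
    using y unfolding decreases_to_zero_def F by (auto simp: t_def)
  moreover have "\<forall>b\<in>Field t. \<exists>a0\<in>Field r. \<forall>a. (a0, a) \<in> r \<longrightarrow> \<bar>x a - l\<bar> \<le> b"
    using dom unfolding F by blast
  ultimately show ?thesis
    unfolding order_convergent_def by blast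
qed


section \<open>Classes of operators\<close>

text \<open>
  The operators are required to be \<open>linear\<close> in \<open>order_bounded_operator\<close>. "Every net" is
  rendered by nets over one index type that is large enough: by \<open>so_continuousD\<close> and
  \<open>order_continuousD\<close> below the definitions imply the same property for nets over any index
  type whatsoever.
\<close>

type_synonym 'a net_index = "'a set \<times> 'a"

definition so_continuous :: "('e::riesz_space \<Rightarrow> 'f::riesz_space) \<Rightarrow> bool" where
  "so_continuous T \<longleftrightarrow>
     (\<forall>(r :: 'e net_index rel) x. directed_set r \<longrightarrow> uo_convergent r x 0 \<longrightarrow>
        order_convergent r (\<lambda>a. T (x a)) 0)"

definition s_sigma_o_continuous :: "('e::riesz_space \<Rightarrow> 'f::riesz_space) \<Rightarrow> bool" where
  "s_sigma_o_continuous T \<longleftrightarrow>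
     (\<forall>x. uo_convergent nat_order x 0 \<longrightarrow> order_convergent nat_order (\<lambda>n. T (x n)) 0)"

definition order_continuous :: "('e::riesz_space \<Rightarrow> 'f::riesz_space) \<Rightarrow> bool" where
  "order_continuous T \<longleftrightarrow>
     (\<forall>(r :: 'e net_index rel) x. directed_set r \<longrightarrow> order_convergent r x 0 \<longrightarrow>
        order_convergent r (\<lambda>a. T (x a)) 0)"

definition sigma_order_continuous :: "('e::riesz_space \<Rightarrow> 'f::riesz_space) \<Rightarrow> bool" where
  "sigma_order_continuous T \<longleftrightarrow>
     (\<forall>x. order_convergent nat_order x 0 \<longrightarrow> order_convergent nat_order (\<lambda>n. T (x n)) 0)"

text \<open>
  Every net has the same tails as a net over the canonical index type: index by pairs of a tail
  and one of its elements, ordered by reverse inclusion of tails.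
\<close>

lemma canonical_net:
  fixes r :: "'i rel" and x :: "'i \<Rightarrow> 'e"
  assumes r: "directed_set r"
  obtains t :: "'e net_index rel" where "directed_set t"
    "\<And>P. (\<exists>b0\<in>Field t. \<forall>b. (b0, b) \<in> t \<longrightarrow> P (snd b)) \<longleftrightarrow>
         (\<exists>a0\<in>Field r. \<forall>a. (a0, a) \<in> r \<longrightarrow> P (x a))"
proof -
  define S where "S = (\<lambda>a0. x ` {a. (a0, a) \<in> r})"
  define I where "I = {(U, u). U \<in> S ` Field r \<and> u \<in> U}"
  define t where "t = {(p, q). p \<in> I \<and> q \<in> I \<and> fst q \<subseteq> fst p}"
  have F: "Field t = I"
    by (auto simp: t_def Field_def)
  have refl: "(a, a) \<in> r" if "a \<in> Field r" for a
    using r that by (auto simp: directed_set_def preorder_on_def refl_on_def)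
  have tr: "(a, c) \<in> r" if "(a, b) \<in> r" "(b, c) \<in> r" for a b c
    using r that by (meson directed_set_def preorder_on_def transD)
  have mono: "S b \<subseteq> S a" if "(a, b) \<in> r" for a b
    using that tr by (auto simp: S_def)
  have mem: "(S a, x a) \<in> I" if "a \<in> Field r" for a
    using that refl by (auto simp: I_def S_def)
  have "\<exists>w. (p, w) \<in> t \<and> (q, w) \<in> t" if pq: "p \<in> Field t" "q \<in> Field t" for p q
  proof -
    obtain a b where ab: "a \<in> Field r" "b \<in> Field r" "fst p = S a" "fst q = S b"
      using pq unfolding F I_def by auto
    obtain c where c: "(a, c) \<in> r" "(b, c) \<in> r"
      using r ab unfolding directed_set_def by blast
    then have "c \<in> Field r"
      by (auto intro: FieldI2)
    then have "(p, (S c, x c)) \<in> t" "(q, (S c, x c)) \<in> t"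
      using mem mono[OF c(1)] mono[OF c(2)] ab pq F by (auto simp: t_def)
    then show ?thesis by blast
  qed
  moreover have "Preorder t"
    unfolding preorder_on_def F by (auto simp: t_def refl_on_def trans_def)
  moreover have "Field t \<noteq> {}"
    using r F mem by (auto simp: directed_set_def)
  ultimately have dir: "directed_set t"
    unfolding directed_set_def by blast
  have "(\<exists>b0\<in>Field t. \<forall>b. (b0, b) \<in> t \<longrightarrow> P (snd b)) \<longleftrightarrow>
        (\<exists>a0\<in>Field r. \<forall>a. (a0, a) \<in> r \<longrightarrow> P (x a))" (is "?L \<longleftrightarrow> ?R") for P
  proof
    assume ?L
    then obtain b0 where b0: "b0 \<in> I" "\<And>b. (b0, b) \<in> t \<Longrightarrow> P (snd b)"
      unfolding F by blast
    obtain a0 where a0: "a0 \<in> Field r" "fst b0 = S a0"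
      using b0(1) unfolding I_def by auto
    have "P (x a)" if "(a0, a) \<in> r" for a
    proof -
      have "a \<in> Field r" using that by (auto intro: FieldI2)
      then have "(b0, (S a, x a)) \<in> t"
        using mem b0(1) mono[OF that] a0 by (auto simp: t_def)
      then show ?thesis using b0(2) by fastforce
    qed
    then show ?R using a0(1) by blast
  next
    assume ?R
    then obtain a0 where a0: "a0 \<in> Field r" "\<And>a. (a0, a) \<in> r \<Longrightarrow> P (x a)"
      by blast
    have "P (snd b)" if "((S a0, x a0), b) \<in> t" for b
    proof -
      have "snd b \<in> fst b" "fst b \<subseteq> S a0"
        using that by (auto simp: t_def I_def)
      then show ?thesis using a0(2) by (auto simp: S_def)
    qed
    then show ?L using mem[OF a0(1)] unfolding F by blast
  qed
  with dir show thesis by (rule that)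
qed

lemma order_convergent_cong:
  assumes "\<And>P. (\<exists>b0\<in>Field t. \<forall>b. (b0, b) \<in> t \<longrightarrow> P (z b)) \<longleftrightarrow>
         (\<exists>a0\<in>Field r. \<forall>a. (a0, a) \<in> r \<longrightarrow> P (x a))"
  shows "order_convergent t (\<lambda>b. g (z b)) l \<longleftrightarrow> order_convergent r (\<lambda>a. g (x a)) l"
  unfolding order_convergent_def
  using assms[of "\<lambda>e. \<bar>g e - l\<bar> \<le> c" for c] by simp

lemma so_continuousD:
  fixes r :: "'i rel"
  assumes T: "so_continuous T" and r: "directed_set r" and x: "uo_convergent r x 0"
  shows "order_convergent r (\<lambda>a. T (x a)) 0"
proof -
  obtain t :: "'a net_index rel" where t: "directed_set t"
    "\<And>P. (\<exists>b0\<in>Field t. \<forall>b. (b0, b) \<in> t \<longrightarrow> P (snd b)) \<longleftrightarrow>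
         (\<exists>a0\<in>Field r. \<forall>a. (a0, a) \<in> r \<longrightarrow> P (x a))"
    using canonical_net[OF r] by blast
  note c = order_convergent_cong[of t snd r x, OF t(2)]
  have "uo_convergent t snd 0"
    using x c[of "\<lambda>e. inf \<bar>e - 0\<bar> u" for u] unfolding uo_convergent_def by simp
  then show ?thesis
    using T t(1) c[of T] unfolding so_continuous_def by blast
qed

lemma order_continuousD:
  fixes r :: "'i rel"
  assumes T: "order_continuous T" and r: "directed_set r" and x: "order_convergent r x 0"
  shows "order_convergent r (\<lambda>a. T (x a)) 0"
proof -
  obtain t :: "'a net_index rel" where t: "directed_set t"
    "\<And>P. (\<exists>b0\<in>Field t. \<forall>b. (b0, b) \<in> t \<longrightarrow> P (snd b)) \<longleftrightarrow>
         (\<exists>a0\<in>Field r. \<forall>a. (a0, a) \<in> r \<longrightarrow> P (x a))"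
    using canonical_net[OF r] by blast
  note c = order_convergent_cong[of t snd r x, OF t(2)]
  have "order_convergent t snd 0"
    using x c[of "\<lambda>e. e"] by simp
  then show ?thesis
    using T t(1) c[of T] unfolding order_continuous_def by blast
qed

definition order_bounded :: "'a::riesz_space set \<Rightarrow> bool" where
  "order_bounded A \<longleftrightarrow> (\<exists>a b. A \<subseteq> {a..b})"

definition order_bounded_operator :: "('e::riesz_space \<Rightarrow> 'f::riesz_space) \<Rightarrow> bool" where
  "order_bounded_operator T \<longleftrightarrow>
     linear T \<and> (\<forall>A. order_bounded A \<longrightarrow> order_bounded (T ` A))"

definition L_b :: "('e::riesz_space \<Rightarrow> 'f::riesz_space) set" where
  "L_b = {T. order_bounded_operator T}"

definition L_so :: "('e::riesz_space \<Rightarrow> 'f::riesz_space) set" where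
  "L_so = {T \<in> L_b. so_continuous T}"

definition L_s_sigma_o :: "('e::riesz_space \<Rightarrow> 'f::riesz_space) set" where
  "L_s_sigma_o = {T \<in> L_b. s_sigma_o_continuous T}"

definition L_n :: "('e::riesz_space \<Rightarrow> 'f::riesz_space) set" where
  "L_n = {T \<in> L_b. order_continuous T}"

definition L_c :: "('e::riesz_space \<Rightarrow> 'f::riesz_space) set" where
  "L_c = {T \<in> L_b. sigma_order_continuous T}"

end

theory Submission
  imports Defs
begin

text \<open>
  In a finite-dimensional Riesz space \<open>E\<close> a net is unbounded order null if and only if it is order
  null (\<open>uo_convergent_0_iff\<close>), so the continuity notions agree pairwise. That order null nets
  are unbounded order null holds in every Riesz space. For the converse, \<open>E\<close> need not be
  Archimedean (it may be the lexicographic plane), so it cannot be identified with some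
  \<open>\<real>\<^sup>n\<close>; two consequences of finite dimension take the place of coordinates.

  First, \<open>E\<close> has a strong order unit \<open>e\<close>, the sum of the moduli of a basis. Second, every net
  \<open>y\<close> that decreases to \<open>0\<close> gets below \<open>e\<close> (\<open>decreases_to_zero_below_order_unit\<close>). Indeed,
  the positive parts \<open>z\<^sub>b\<close> of \<open>y\<^sub>b - e\<close> decrease, so their disjoint complements form an
  increasing family of subspaces, which is constant from some \<open>b\<^sub>1\<close> on. The positive part of
  \<open>e - y\<^sub>b\<close> is disjoint from \<open>z\<^sub>b\<close>, hence from \<open>u = z\<^bsub>b\<^sub>1\<^esub>\<close>; therefore \<open>u \<sqinter> e\<close> stays below
  \<open>y\<^sub>b\<close> for all late \<open>b\<close>. So \<open>u \<sqinter> e = 0\<close>, whence \<open>u = 0\<close> and \<open>y\<^bsub>b\<^sub>1\<^esub> \<le> e\<close>.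

  If \<open>\<bar>x\<bar> \<sqinter> 2e\<close> is dominated by \<open>y\<^sub>b \<le> e\<close>, then the truncation by \<open>2e\<close> is not active:
  \<open>\<bar>x\<bar> \<le> e\<close>, so \<open>\<bar>x\<bar>\<close> itself is dominated by \<open>y\<^sub>b\<close>. Thus the net dominating the truncations
  of an unbounded order null net eventually dominates the net itself.
\<close>

section \<open>Lattice inequalities\<close>

lemma abs_scaleR_le:
  fixes x :: "'a::riesz_space"
  shows "\<bar>c *\<^sub>R x\<bar> \<le> \<bar>c\<bar> *\<^sub>R \<bar>x\<bar>"
proof (rule abs_leI)
  have pos: "d *\<^sub>R w \<le> \<bar>d\<bar> *\<^sub>R \<bar>w\<bar>" for d and w :: 'a
  proof (cases "d \<ge> 0")
    case True
    then show ?thesis by (simp add: scaleR_left_mono abs_ge_self)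
  next
    case False
    then have "(- d) *\<^sub>R (- w) \<le> (- d) *\<^sub>R \<bar>w\<bar>"
      by (intro scaleR_left_mono) (auto simp: abs_ge_minus_self)
    with False show ?thesis by simp
  qed
  show "c *\<^sub>R x \<le> \<bar>c\<bar> *\<^sub>R \<bar>x\<bar>" by (rule pos)
  show "- (c *\<^sub>R x) \<le> \<bar>c\<bar> *\<^sub>R \<bar>x\<bar>" using pos[of "- c" x] by simp
qed

lemma inf_add_le_add_inf:
  fixes p q z :: "'a::riesz_space"
  assumes "0 \<le> p" "0 \<le> q" "0 \<le> z"
  shows "inf (p + q) z \<le> inf p z + inf q z"
proof -
  let ?t = "inf (p + q) z"
  have t: "?t \<le> p + q" "?t \<le> z" by simp_all
  have "?t \<le> p + z" "?t \<le> z + q" "?t \<le> z + z"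
    using add_increasing[OF assms(1) t(2)] add_increasing2[OF assms(2) t(2)]
      add_increasing[OF assms(3) t(2)] by simp_all
  with t(1) show ?thesis
    by (simp add: add_inf_distrib_left add_inf_distrib_right)
qed

lemma inf_positive_parts_eq_0:
  fixes a b :: "'a::riesz_space"
  shows "inf (sup (a - b) 0) (sup (b - a) 0) = 0"
proof -
  define s where "s = sup (b - a) 0"
  have pos: "sup (a - b) 0 = (a - b) + s"
    unfolding s_def by (simp add: add_sup_distrib_left sup_commute)
  have neg: "s = - inf (a - b) 0"
    unfolding s_def by (simp add: neg_inf_eq_sup)
  have "inf (sup (a - b) 0) s = inf (a - b) 0 + s"
    unfolding pos using add_inf_distrib_right[of "a - b" 0 s] by simp
  also have "\<dots> = 0" by (subst neg) (rule add.right_inverse)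
  finally show ?thesis by (simp add: s_def)
qed

section \<open>Disjoint complements\<close>

definition disjoint_complement :: "'a::riesz_space \<Rightarrow> 'a set" where
  "disjoint_complement z = {x. inf \<bar>x\<bar> z = 0}"

lemma disjoint_complementI:
  assumes "inf \<bar>x\<bar> z \<le> 0" "0 \<le> z"
  shows "x \<in> disjoint_complement z"
  unfolding disjoint_complement_def mem_Collect_eq
  using assms by (intro antisym) simp_all

lemma disjoint_complement_solid:
  assumes "x \<in> disjoint_complement z" "\<bar>w\<bar> \<le> \<bar>x\<bar>" "0 \<le> z"
  shows "w \<in> disjoint_complement z"
proof -
  have "inf \<bar>w\<bar> z \<le> inf \<bar>x\<bar> z" using assms(2) by (meson inf_mono order_refl)
  also have "\<dots> = 0" using assms(1) by (simp add: disjoint_complement_def)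
  finally show ?thesis using assms(3) by (rule disjoint_complementI)
qed

lemma disjoint_complement_antimono:
  assumes "z \<le> w" "0 \<le> z"
  shows "disjoint_complement w \<subseteq> disjoint_complement z"
proof
  fix x assume x: "x \<in> disjoint_complement w"
  have "inf \<bar>x\<bar> z \<le> inf \<bar>x\<bar> w" using assms(1) by (meson inf_mono order_refl)
  also have "\<dots> = 0" using x by (simp add: disjoint_complement_def)
  finally show "x \<in> disjoint_complement z" using assms(2) by (rule disjoint_complementI)
qed

lemma subspace_disjoint_complement:
  assumes z: "0 \<le> z"
  shows "subspace (disjoint_complement z)"
proof -
  have add: "x + y \<in> disjoint_complement z"
    if "x \<in> disjoint_complement z" "y \<in> disjoint_complement z" for x y
  proof -
    have "\<bar>x + y\<bar> \<le> \<bar>x\<bar> + \<bar>y\<bar>" by (rule abs_triangle_ineq)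
    then have "inf \<bar>x + y\<bar> z \<le> inf (\<bar>x\<bar> + \<bar>y\<bar>) z" by (meson inf_mono order_refl)
    also have "\<dots> \<le> inf \<bar>x\<bar> z + inf \<bar>y\<bar> z" using z by (intro inf_add_le_add_inf) simp_all
    also have "\<dots> = 0" using that by (simp add: disjoint_complement_def)
    finally show ?thesis using z by (rule disjoint_complementI)
  qed
  have zero: "0 \<in> disjoint_complement z"
    using z by (simp add: disjoint_complement_def inf_absorb1)
  have scale: "c *\<^sub>R x \<in> disjoint_complement z" if x: "x \<in> disjoint_complement z" for c x
  proof -
    have multiple: "real n *\<^sub>R \<bar>x\<bar> \<in> disjoint_complement z" for n
    proof (induction n)
      case (Suc n)
      have "\<bar>x\<bar> \<in> disjoint_complement z" using x by (simp add: disjoint_complement_def)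
      from add[OF this Suc] show ?case by (simp add: scaleR_add_left)
    qed (simp add: zero)
    obtain n where n: "\<bar>c\<bar> \<le> real n" using real_arch_simple by blast
    have "\<bar>c *\<^sub>R x\<bar> \<le> \<bar>c\<bar> *\<^sub>R \<bar>x\<bar>" by (rule abs_scaleR_le)
    also have "\<dots> \<le> real n *\<^sub>R \<bar>x\<bar>" using n by (simp add: scaleR_right_mono)
    also have "\<dots> \<le> \<bar>real n *\<^sub>R \<bar>x\<bar>\<bar>" by (rule abs_ge_self)
    finally show ?thesis by (rule disjoint_complement_solid[OF multiple _ z])
  qed
  show ?thesis using zero add scale by (simp add: subspace_def)
qed

section \<open>Strong order units\<close>

definition order_unit :: "'a::riesz_space \<Rightarrow> bool" where
  "order_unit e \<longleftrightarrow> 0 \<le> e \<and> (\<forall>x. \<exists>n. \<bar>x\<bar> \<le> real n *\<^sub>R e)"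

text \<open>Truncations at \<open>n e\<close> stay below \<open>e\<close> by induction on \<open>n\<close>: raising the level by \<open>e\<close> raises the
  truncation by at most \<open>e\<close>, so it stays below \<open>2e\<close>, where the hypothesis brings it back below
  \<open>e\<close>. For large \<open>n\<close> the truncation of \<open>x\<close> is \<open>x\<close> itself.\<close>

lemma le_if_truncation_le:
  fixes x :: "'a::riesz_space"
  assumes e: "order_unit e" and trunc: "inf x (2 *\<^sub>R e) \<le> e"
  shows "x \<le> e"
proof -
  have "inf x (real n *\<^sub>R e) \<le> e" for n
  proof (induction n)
    case 0
    then show ?case using e by (simp add: order_unit_def le_infI2)
  next
    case (Suc n)
    let ?t = "inf x (real (Suc n) *\<^sub>R e)"
    have "?t \<le> x + e" using e by (simp add: order_unit_def le_infI1 add_increasing2)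
    moreover have "?t \<le> real n *\<^sub>R e + e"
      by (simp add: scaleR_add_left add.commute)
    ultimately have "?t \<le> inf x (real n *\<^sub>R e) + e"
      by (simp add: add_inf_distrib_right)
    also have "\<dots> \<le> e + e" using Suc by simp
    also have "\<dots> = 2 *\<^sub>R e" by (simp add: scaleR_2)
    finally have "?t \<le> inf x (2 *\<^sub>R e)" by simp
    with trunc show ?case by (rule order_trans[rotated])
  qed
  moreover obtain n where "\<bar>x\<bar> \<le> real n *\<^sub>R e" using e unfolding order_unit_def by blast
  then have "inf x (real n *\<^sub>R e) = x" by (simp add: inf_absorb1 abs_le_iff)
  ultimately show ?thesis by metis
qed

text \<open>The disjoint complement of \<open>u\<close> is a solid subspace, so with \<open>e\<close> it contains \<open>u\<close>.\<close>

lemma disjoint_from_order_unit_eq_0: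
  assumes e: "order_unit e" and u: "0 \<le> u" and disj: "inf e u = 0"
  shows "u = 0"
proof -
  have e0: "0 \<le> e" using e by (simp add: order_unit_def)
  have "e \<in> disjoint_complement u" using disj e0 by (simp add: disjoint_complement_def)
  then have multiple: "real n *\<^sub>R e \<in> disjoint_complement u" for n
    by (rule subspace_scale[OF subspace_disjoint_complement[OF u]])
  obtain n where "\<bar>u\<bar> \<le> real n *\<^sub>R e" using e unfolding order_unit_def by blast
  also have "\<dots> \<le> \<bar>real n *\<^sub>R e\<bar>" by (rule abs_ge_self)
  finally have "u \<in> disjoint_complement u" by (rule disjoint_complement_solid[OF multiple _ u])
  then show ?thesis using u by (simp add: disjoint_complement_def)
qed

lemma order_unit_if_spanning:
  fixes B :: "'a::riesz_space set"
  assumes "finite B" and span: "span B = UNIV"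
  shows "order_unit (\<Sum>b\<in>B. \<bar>b\<bar>)"
proof -
  let ?e = "\<Sum>b\<in>B. \<bar>b\<bar>"
  have e0: "0 \<le> ?e" by (simp add: sum_nonneg)
  have "\<exists>n. \<bar>x\<bar> \<le> real n *\<^sub>R ?e" for x
  proof -
    have "x \<in> span B" using span by simp
    then show ?thesis
    proof (induction rule: span_induct_alt)
      case base
      show ?case by (rule exI[of _ 0]) simp
    next
      case (step c b y)
      obtain n where n: "\<bar>y\<bar> \<le> real n *\<^sub>R ?e" using step by blast
      obtain m where m: "\<bar>c\<bar> \<le> real m" using real_arch_simple by blast
      have "\<bar>c *\<^sub>R b\<bar> \<le> \<bar>c\<bar> *\<^sub>R \<bar>b\<bar>" by (rule abs_scaleR_le)
      also have "\<dots> \<le> real m *\<^sub>R \<bar>b\<bar>" using m by (simp add: scaleR_right_mono)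
      also have "\<dots> \<le> real m *\<^sub>R ?e"
        using step(1) \<open>finite B\<close> sum_mono2[of B "{b}" abs]
        by (intro scaleR_left_mono) simp_all
      finally have "\<bar>c *\<^sub>R b + y\<bar> \<le> real m *\<^sub>R ?e + real n *\<^sub>R ?e"
        using n by (meson abs_triangle_ineq add_mono order_trans)
      then have "\<bar>c *\<^sub>R b + y\<bar> \<le> real (m + n) *\<^sub>R ?e" by (simp add: scaleR_add_left)
      then show ?case by blast
    qed
  qed
  with e0 show ?thesis by (simp add: order_unit_def)
qed

section \<open>Nets decreasing to zero in finite dimension\<close>

text \<open>Finite dimension enters through the choice of an index whose disjoint complement has maximal
  dimension; from there on the complements cannot grow.\<close>

lemma decreases_to_zero_below_order_unit:
  fixes y :: "'i \<Rightarrow> 'a::riesz_space"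
  assumes fd: "finite_dimensional_vector_space ((*\<^sub>R) :: real \<Rightarrow> 'a \<Rightarrow> 'a) B"
    and s: "directed_set s" and y: "decreases_to_zero s y" and e: "order_unit e"
  shows "\<exists>b\<in>Field s. y b \<le> e"
proof -
  interpret fd: finite_dimensional_vector_space "(*\<^sub>R) :: real \<Rightarrow> 'a \<Rightarrow> 'a" B by (rule fd)
  define z where "z b = sup (y b - e) 0" for b
  define D where "D b = disjoint_complement (z b)" for b
  have z0: "0 \<le> z b" for b by (simp add: z_def)
  have sub: "subspace (D b)" for b
    using subspace_disjoint_complement[OF z0] by (simp add: D_def)
  have e0: "0 \<le> e" using e by (simp add: order_unit_def)
  have y_mono: "y c \<le> y b" if "(b, c) \<in> s" for b c
    using y that by (simp add: decreases_to_zero_def)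
  have glb: "isGlb UNIV (y ` Field s) 0" using y by (simp add: decreases_to_zero_def)
  then have y0: "0 \<le> y b" if "b \<in> Field s" for b
    using that by (auto simp: isGlb_def greatestP_def isLb_def setge_def)
  have D_mono: "D b \<subseteq> D c" if "(b, c) \<in> s" for b c
  proof -
    have "z c \<le> z b" unfolding z_def
      using y_mono[OF that] by (intro sup_mono diff_right_mono order_refl)
    then show ?thesis unfolding D_def by (rule disjoint_complement_antimono[OF _ z0])
  qed
  obtain b0 where "b0 \<in> Field s" using s by (auto simp: directed_set_def)
  moreover have "\<forall>b. b \<in> Field s \<longrightarrow> dim (D b) < Suc (dim (UNIV :: 'a set))"
    using fd.dim_subset[folded dim_raw_def, OF subset_UNIV] by (simp add: less_Suc_eq_le)
  ultimately have "\<exists>b1. b1 \<in> Field s \<and> (\<forall>b. b \<in> Field s \<longrightarrow> dim (D b) \<le> dim (D b1))"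
    by (rule ex_has_greatest_nat)
  then obtain b1 where b1: "b1 \<in> Field s"
    and max: "\<And>b. b \<in> Field s \<Longrightarrow> dim (D b) \<le> dim (D b1)"
    by blast
  have stable: "D c = D b1" if "(b1, c) \<in> s" for c
    using fd.subspace_dim_equal[folded dim_raw_def subspace_raw_def, OF sub sub D_mono[OF that]]
      max[OF FieldI2[OF that]] by simp
  have late: "inf e (z b1) \<le> y c" if c: "(b1, c) \<in> s" for c
  proof -
    let ?n = "sup (e - y c) 0"
    have "inf ?n (z c) = 0"
      unfolding z_def by (rule inf_positive_parts_eq_0)
    then have "?n \<in> D c" by (simp add: D_def disjoint_complement_def)
    then have "?n \<in> D b1" by (simp only: stable[OF c])
    then have disj: "inf ?n (z b1) = 0" by (simp add: D_def disjoint_complement_def)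
    \<comment> \<open>The difference of \<open>e \<sqinter> z\<^bsub>b\<^sub>1\<^esub>\<close> and \<open>y\<^sub>c\<close> lies below both of these disjoint elements.\<close>
    have "inf e (z b1) - y c \<le> ?n" by (intro le_supI1 diff_right_mono inf.cobounded1)
    moreover have "inf e (z b1) - y c \<le> z b1"
      using y0[OF FieldI2[OF c]] by (metis diff_zero diff_mono inf.cobounded2)
    ultimately have "inf e (z b1) - y c \<le> inf ?n (z b1)" by (rule inf.boundedI)
    then show ?thesis unfolding disj by simp
  qed
  have "inf e (z b1) \<le> y b" if b: "b \<in> Field s" for b
  proof -
    obtain c where "(b, c) \<in> s" "(b1, c) \<in> s" using s b b1 unfolding directed_set_def by blast
    then show ?thesis using order_trans[OF late y_mono] by blast
  qed
  then have "inf e (z b1) \<le> 0"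
    using glb by (auto simp: isGlb_def greatestP_def isLb_def setge_def setle_def)
  moreover have "0 \<le> inf e (z b1)" using e0 z0 by simp
  ultimately have "inf e (z b1) = 0" by (rule antisym)
  then have "z b1 = 0" by (rule disjoint_from_order_unit_eq_0[OF e z0])
  then have "y b1 - e \<le> 0" unfolding z_def by (metis sup_ge1)
  then show ?thesis using b1 by auto
qed

section \<open>Unbounded order null nets are order null\<close>

lemma order_convergent_imp_uo_convergent_0:
  fixes x :: "'i \<Rightarrow> 'a::riesz_space"
  assumes "order_convergent r x 0"
  shows "uo_convergent r x 0"
  unfolding uo_convergent_def
proof (intro allI impI)
  fix u :: 'a assume u: "0 \<le> u"
  have "\<bar>inf \<bar>x a - 0\<bar> u - 0\<bar> \<le> \<bar>x a - 0\<bar>" for a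
    using u by (simp add: abs_of_nonneg)
  then show "order_convergent r (\<lambda>a. inf \<bar>x a - 0\<bar> u) 0"
    using assms unfolding order_convergent_def by (meson order_trans)
qed

lemma uo_convergent_0_iff:
  fixes x :: "'i \<Rightarrow> 'a::riesz_space"
  assumes fd: "finite_dimensional_vector_space ((*\<^sub>R) :: real \<Rightarrow> 'a \<Rightarrow> 'a) B"
  shows "uo_convergent r x 0 \<longleftrightarrow> order_convergent r x 0"
proof
  interpret fd: finite_dimensional_vector_space "(*\<^sub>R) :: real \<Rightarrow> 'a \<Rightarrow> 'a" B by (rule fd)
  assume uo: "uo_convergent r x 0"
  define e where "e = (\<Sum>b\<in>B. \<bar>b\<bar>)"
  have e: "order_unit e"
    unfolding e_def
    using fd.finite_Basis fd.span_Basis by (intro order_unit_if_spanning) (simp_all add: span_raw_def)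
  then have "0 \<le> 2 *\<^sub>R e" by (simp add: order_unit_def scaleR_nonneg_nonneg)
  with uo have "order_convergent r (\<lambda>a. inf \<bar>x a - 0\<bar> (2 *\<^sub>R e)) 0"
    unfolding uo_convergent_def by blast
  then obtain s :: "'a rel" and y where s: "directed_set s" and y: "decreases_to_zero s y"
    and dom: "\<And>b. b \<in> Field s \<Longrightarrow>
      \<exists>a0\<in>Field r. \<forall>a. (a0, a) \<in> r \<longrightarrow> \<bar>inf \<bar>x a - 0\<bar> (2 *\<^sub>R e) - 0\<bar> \<le> y b"
    unfolding order_convergent_def by blast
  obtain b1 where b1: "b1 \<in> Field s" "y b1 \<le> e"
    using decreases_to_zero_below_order_unit[OF fd s y e] by blast
  show "order_convergent r x 0"
  proof (rule order_convergentI[OF s y])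
    fix b assume "b \<in> Field s"
    then obtain c where c: "(b, c) \<in> s" "(b1, c) \<in> s"
      using s b1(1) unfolding directed_set_def by blast
    then have yc: "y c \<le> y b" "y c \<le> y b1"
      using y unfolding decreases_to_zero_def by blast+
    obtain a0 where a0: "a0 \<in> Field r"
      and bound: "\<And>a. (a0, a) \<in> r \<Longrightarrow> \<bar>inf \<bar>x a - 0\<bar> (2 *\<^sub>R e) - 0\<bar> \<le> y c"
      using dom[OF FieldI2[OF c(1)]] by blast
    have "\<bar>x a - 0\<bar> \<le> y b" if "(a0, a) \<in> r" for a
    proof -
      have trunc: "inf \<bar>x a\<bar> (2 *\<^sub>R e) \<le> y c"
        using order_trans[OF abs_ge_self bound[OF that]] by simp
      then have "inf \<bar>x a\<bar> (2 *\<^sub>R e) \<le> e" using yc(2) b1(2) by (meson order_trans)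
      then have "\<bar>x a\<bar> \<le> e" by (rule le_if_truncation_le[OF e])
      also have "e \<le> 2 *\<^sub>R e" using e by (simp add: order_unit_def scaleR_2)
      finally have "inf \<bar>x a\<bar> (2 *\<^sub>R e) = \<bar>x a\<bar>" by (rule inf_absorb1)
      with trunc yc(1) show ?thesis by simp
    qed
    with a0 show "\<exists>a0\<in>Field r. \<forall>a. (a0, a) \<in> r \<longrightarrow> \<bar>x a - 0\<bar> \<le> y b" by blast
  qed
qed (rule order_convergent_imp_uo_convergent_0)

theorem proposition1:
  assumes "\<exists>B. finite_dimensional_vector_space ((*\<^sub>R) :: real \<Rightarrow> 'e::riesz_space \<Rightarrow> 'e) B"
  shows "(L_so :: ('e \<Rightarrow> 'f::riesz_space) set) = L_n \<and>
         (L_s_sigma_o :: ('e \<Rightarrow> 'f) set) = L_c"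
proof -
  obtain B where "finite_dimensional_vector_space ((*\<^sub>R) :: real \<Rightarrow> 'e \<Rightarrow> 'e) B"
    using assms by blast
  then show ?thesis
    unfolding L_so_def L_n_def L_s_sigma_o_def L_c_def so_continuous_def order_continuous_def
      s_sigma_o_continuous_def sigma_order_continuous_def
    by (simp add: uo_convergent_0_iff)
qed

end
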